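(* Suppose $\Psi(s-t)=\phi(\|s-t\|_2)$, where $\phi(r)>0$ is a strictly decreasing function of $r\in\mathbb{R}^+$ with $\phi(0)=1$, and the reproducing kernel Hilbert space generated by $\Psi$ can be embedded into a Sobolev space $H^{m}(\Omega)$ with $m>d/2$. Let $\{\epsilon_n\}$ be a sequence of independent random vectors in $\mathbb{R}^d$ that converges to $0$ in distribution, and let $$a_n=\frac{\sigma^2}{(2\pi)^{d/2}}\int_{\mathbb{R}^d}\big|1-|b_n(t)|\big|^2\,\mathcal{F}(\Psi)(t)\,dt,\qquad b_n(t)=\mathbb{E}(e^{i\epsilon_n^Tt}).$$ Then $a_n$ converges to zero.
   Context: $\Omega\subset\mathbb{R}^d$ is convex and compact; $\sigma^2>0$ is a constant; $\Psi\in L_1(\mathbb{R}^d)\cap C(\mathbb{R}^d)$ is a positive definite correlation function with $\Psi(0)=1$. $\mathcal{F}(g)(\omega)=(2\pi)^{-d/2}\int_{\mathbb{R}^d}g(x)e^{-ix^T\omega}dx$ is the Fourier transform. The reproducing kernel Hilbert space generated by $\Psi$ on $\mathbb{R}^d$ is $\mathcal{N}_\Psi(\mathbb{R}^d)=\{g\in L_2(\mathbb{R}^d)\cap C(\mathbb{R}^d):\mathcal{F}(g)/\sqrt{\mathcal{F}(\Psi)}\in L_2(\mathbb{R}^d)\}$ with $\langle g_1,g_2\rangle=(2\pi)^{-d/2}\int \mathcal{F}(g_1)\overline{\mathcal{F}(g_2)}/\mathcal{F}(\Psi)$; on $\Omega$ it consists of restrictions with norm $\inf\{\|g_E\|_{\mathcal{N}_\Psi(\mathbb{R}^d)}:g_E|_\Omega=g\}$.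 $H^m(\Omega)$ is defined likewise by restriction from $H^m(\mathbb{R}^d)=\{g\in L_2: |\mathcal{F}(g)|(1+\|\cdot\|_2^2)^{m/2}\in L_2\}$. *)

theory Defs
  imports "HOL-Probability.Probability"
begin

section \<open>Fourier transforms\<close>

definition fourier :: "('a::euclidean_space \<Rightarrow> real) \<Rightarrow> 'a \<Rightarrow> complex" where
  "fourier g \<omega> = complex_of_real ((2 * pi) powr (- real DIM('a) / 2)) *
     (LINT x|lborel. complex_of_real (g x) * exp (- \<i> * complex_of_real (x \<bullet> \<omega>)))"

definition L2 :: "('a::euclidean_space \<Rightarrow> 'b::euclidean_space) set" where
  "L2 = {g \<in> borel_measurable lborel. integrable lborel (\<lambda>x. (norm (g x))\<^sup>2)}"

text \<open>
  The integral above need not converge for \<open>g\<close> in \<open>L\<^sub>2\<close>. There the transform is the continuous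
  extension from \<open>L\<^sub>1 \<inter> L\<^sub>2\<close>, determined up to null sets; all notions below depend
  only on its almost-everywhere class. The squared \<open>L\<^sub>2\<close> distances are nonnegative integrals, so
  that a divergent one counts as infinite rather than 0.
\<close>

definition is_L2_fourier :: "('a::euclidean_space \<Rightarrow> real) \<Rightarrow> ('a \<Rightarrow> complex) \<Rightarrow> bool" where
  "is_L2_fourier g h \<longleftrightarrow> g \<in> L2 \<and> h \<in> L2 \<and>
     (\<exists>u. (\<forall>k::nat. integrable lborel (u k) \<and> u k \<in> L2) \<and>
       (\<lambda>k. \<integral>\<^sup>+ x. ennreal ((norm (u k x - g x))\<^sup>2) \<partial>lborel) \<longlonglongrightarrow> 0 \<and>
       (\<lambda>k. \<integral>\<^sup>+ \<omega>. ennreal ((norm (fourier (u k) \<omega> - h \<omega>))\<^sup>2) \<partial>lborel) \<longlonglongrightarrow> 0)"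

definition fourier_L2 :: "('a::euclidean_space \<Rightarrow> real) \<Rightarrow> 'a \<Rightarrow> complex" where
  "fourier_L2 g = (SOME h. is_L2_fourier g h)"


section \<open>Correlation functions and their native spaces\<close>

text \<open>
  Indexing by finite sets makes the points pairwise distinct. Real coefficients suffice
  because \<open>\<Psi>\<close> is real and even.
\<close>

definition positive_definite :: "('a::euclidean_space \<Rightarrow> real) \<Rightarrow> bool" where
  "positive_definite \<Psi> \<longleftrightarrow> (\<forall>x. \<Psi> (- x) = \<Psi> x) \<and>
     (\<forall>X c. finite X \<longrightarrow> (\<exists>x\<in>X. c x \<noteq> 0) \<longrightarrow>
        (\<Sum>x\<in>X. \<Sum>y\<in>X. c x * c y * \<Psi> (x - y)) > (0::real))"

text \<open>
  Division by 0 yields 0 here, so the first condition on the transform is needed where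
  \<open>fourier \<Psi>\<close> vanishes: there the quotient is square integrable only if the numerator
  vanishes almost everywhere.
\<close>

definition native_space :: "('a::euclidean_space \<Rightarrow> real) \<Rightarrow> ('a \<Rightarrow> real) set" where
  "native_space \<Psi> = {g \<in> L2. continuous_on UNIV g \<and>
     (AE \<omega> in lborel. fourier \<Psi> \<omega> = 0 \<longrightarrow> fourier_L2 g \<omega> = 0) \<and>
     (\<lambda>\<omega>. fourier_L2 g \<omega> / csqrt (fourier \<Psi> \<omega>)) \<in> L2}"

definition native_inner ::
    "('a::euclidean_space \<Rightarrow> real) \<Rightarrow> ('a \<Rightarrow> real) \<Rightarrow> ('a \<Rightarrow> real) \<Rightarrow> complex" where
  "native_inner \<Psi> g\<^sub>1 g\<^sub>2 = complex_of_real ((2 * pi) powr (- real DIM('a) / 2)) *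
     (LINT \<omega>|lborel. fourier_L2 g\<^sub>1 \<omega> * cnj (fourier_L2 g\<^sub>2 \<omega>) / fourier \<Psi> \<omega>)"

definition native_norm :: "('a::euclidean_space \<Rightarrow> real) \<Rightarrow> ('a \<Rightarrow> real) \<Rightarrow> real" where
  "native_norm \<Psi> g = sqrt (Re (native_inner \<Psi> g g))"

text \<open>
  A function on \<open>\<Omega>\<close> is represented by a function on the whole space whose values
  outside \<open>\<Omega>\<close> are disregarded.
\<close>

definition native_space_on ::
    "('a::euclidean_space \<Rightarrow> real) \<Rightarrow> 'a set \<Rightarrow> ('a \<Rightarrow> real) set" where
  "native_space_on \<Psi> \<Omega> = {g. \<exists>g\<^sub>E \<in> native_space \<Psi>. \<forall>x\<in>\<Omega>. g\<^sub>E x = g x}"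

definition native_norm_on ::
    "('a::euclidean_space \<Rightarrow> real) \<Rightarrow> 'a set \<Rightarrow> ('a \<Rightarrow> real) \<Rightarrow> real" where
  "native_norm_on \<Psi> \<Omega> g =
     Inf {native_norm \<Psi> g\<^sub>E | g\<^sub>E. g\<^sub>E \<in> native_space \<Psi> \<and> (\<forall>x\<in>\<Omega>. g\<^sub>E x = g x)}"


section \<open>Sobolev spaces\<close>

definition sobolev_weighted :: "real \<Rightarrow> ('a::euclidean_space \<Rightarrow> real) \<Rightarrow> 'a \<Rightarrow> real" where
  "sobolev_weighted m g \<omega> = cmod (fourier_L2 g \<omega>) * (1 + (norm \<omega>)\<^sup>2) powr (m / 2)"

definition sobolev_space :: "real \<Rightarrow> ('a::euclidean_space \<Rightarrow> real) set" where
  "sobolev_space m = {g \<in> L2. sobolev_weighted m g \<in> L2}"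

definition sobolev_norm :: "real \<Rightarrow> ('a::euclidean_space \<Rightarrow> real) \<Rightarrow> real" where
  "sobolev_norm m g = sqrt (LINT \<omega>|lborel. (sobolev_weighted m g \<omega>)\<^sup>2)"

text \<open>
  Elements of Sobolev spaces are classes modulo null sets, so an extension need only agree with
  \<open>g\<close> almost everywhere on \<open>\<Omega>\<close>.
\<close>

definition sobolev_space_on :: "real \<Rightarrow> 'a::euclidean_space set \<Rightarrow> ('a \<Rightarrow> real) set" where
  "sobolev_space_on m \<Omega> =
     {g. \<exists>g\<^sub>E \<in> sobolev_space m. AE x in lborel. x \<in> \<Omega> \<longrightarrow> g\<^sub>E x = g x}"

definition sobolev_norm_on ::
    "real \<Rightarrow> 'a::euclidean_space set \<Rightarrow> ('a \<Rightarrow> real) \<Rightarrow> real" where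
  "sobolev_norm_on m \<Omega> g =
     Inf {sobolev_norm m g\<^sub>E | g\<^sub>E. g\<^sub>E \<in> sobolev_space m \<and>
            (AE x in lborel. x \<in> \<Omega> \<longrightarrow> g\<^sub>E x = g x)}"

definition native_embeds_sobolev ::
    "('a::euclidean_space \<Rightarrow> real) \<Rightarrow> real \<Rightarrow> 'a set \<Rightarrow> bool" where
  "native_embeds_sobolev \<Psi> m \<Omega> \<longleftrightarrow>
     native_space_on \<Psi> \<Omega> \<subseteq> sobolev_space_on m \<Omega> \<and>
     (\<exists>C. \<forall>g \<in> native_space_on \<Psi> \<Omega>. sobolev_norm_on m \<Omega> g \<le> C * native_norm_on \<Psi> \<Omega> g)"


section \<open>Convergence in distribution of random vectors\<close>

text \<open>The library's \<open>weak_conv_m\<close> only covers measures on the real line.\<close>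

definition weakly_converges :: "(nat \<Rightarrow> 'a::euclidean_space measure) \<Rightarrow> 'a measure \<Rightarrow> bool" where
  "weakly_converges \<mu> \<nu> \<longleftrightarrow>
     (\<forall>f::'a \<Rightarrow> real. continuous_on UNIV f \<and> bounded (range f) \<longrightarrow>
        (\<lambda>n. integral\<^sup>L (\<mu> n) f) \<longlonglongrightarrow> integral\<^sup>L \<nu> f)"

end

theory Submission
  imports Defs
begin

text \<open>
  Everything rests on the integrability of the transform of \<open>\<Psi>\<close>: since \<open>b\<^sub>n \<rightarrow> 1\<close> pointwise and
  \<open>\<bar>1 - \<bar>b\<^sub>n\<bar>\<bar> \<le> 1\<close>, dominated convergence then gives the result. Averaging the positive definite
  kernel \<open>\<Psi> (x - y) cos ((x - y) \<bullet> \<omega>)\<close> over large balls shows that the transform is nonnegative,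
  and a nonnegative transform of a bounded integrable function is integrable, by Gaussian
  summation and Fatou's lemma.
\<close>


section \<open>Averages of positive definite kernels\<close>

text \<open>The transform of an integrable continuous function can fail to be integrable, and then
  it offers no majorant for the integrals in \<open>a\<close>; positive definiteness closes this
  gap. It speaks of finite sums, however, while the transform is an integral. Random sampling
  bridges the difference: expectations of the finite sums are double integrals, so no Riemann sums
  have to be controlled. The step from double to single integrals rests on the geometry of balls: a
  ball and a fixed translate of it overlap in almost their whole volume once the radius is
  large.\<close>

lemma positive_definite_sum_nonneg:
  assumes "positive_definite \<Psi>" "finite I"
  shows "0 \<le> (\<Sum>i\<in>I. \<Sum>j\<in>I. c (p i) * c (p j) * \<Psi> (p i - p j))"
proof -
  \<comment> \<open>The points \<open>p i\<close> may repeat, whereas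
    \<open>positive_definite\<close> sums over sets. Grouping equal points multiplies each
    coefficient by its multiplicity \<open>n x\<close>.\<close>
  define n where "n x = real (card {i\<in>I. p i = x})" for x
  have group: "(\<Sum>i\<in>I. h (p i)) = (\<Sum>x\<in>p ` I. n x * h x)" for h :: "'a \<Rightarrow> real"
  proof -
    have "(\<Sum>i\<in>I. h (p i)) = (\<Sum>x\<in>p ` I. \<Sum>i\<in>{i\<in>I. p i = x}. h (p i))"
      by (rule sum.image_gen[OF \<open>finite I\<close>])
    also have "\<dots> = (\<Sum>x\<in>p ` I. n x * h x)"
      by (intro sum.cong refl) (auto simp: n_def)
    finally show ?thesis .
  qed
  have "(\<Sum>i\<in>I. \<Sum>j\<in>I. c (p i) * c (p j) * \<Psi> (p i - p j)) =
      (\<Sum>x\<in>p ` I. n x * (\<Sum>y\<in>p ` I. n y * (c x * c y * \<Psi> (x - y))))"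
    by (simp add: group[of "\<lambda>y. c _ * c y * \<Psi> (_ - y)"]
        group[of "\<lambda>x. \<Sum>y\<in>p ` I. n y * (c x * c y * \<Psi> (x - y))"])
  also have "\<dots> = (\<Sum>x\<in>p ` I. \<Sum>y\<in>p ` I. (n x * c x) * (n y * c y) * \<Psi> (x - y))"
    by (simp add: sum_distrib_left mult_ac)
  also have "\<dots> \<ge> 0"
  proof (cases "\<exists>x\<in>p ` I. n x * c x \<noteq> 0")
    case True
    then show ?thesis
      using assms unfolding positive_definite_def
      by (intro less_imp_le) (elim conjE allE[of _ "p ` I"] allE[of _ "\<lambda>x. n x * c x"], simp)
  next
    case False
    then show ?thesis by (simp add: sum.neutral)
  qed
  finally show ?thesis .
qed

lemma positive_definite_bound:
  assumes "positive_definite \<Psi>"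
  shows "\<bar>\<Psi> x\<bar> \<le> \<Psi> 0"
proof -
  have even: "\<Psi> (- x) = \<Psi> x"
    using assms by (simp add: positive_definite_def)
  \<comment> \<open>This is the quadratic form at the points \<open>0\<close> and \<open>x\<close>
    with weights \<open>1\<close> and \<open>s\<close>; the choices \<open>s = 1\<close> and
    \<open>s = -1\<close> bound \<open>\<Psi> x\<close> from below and above. For
    \<open>x = 0\<close> the two points coincide, which needs a separate case.\<close>
  have "0 \<le> (1 + s * s) * \<Psi> 0 + 2 * s * \<Psi> x" if "s \<noteq> 0" for s
  proof (cases "x = 0")
    case True
    have "0 \<le> 1 * \<Psi> 0"
      using positive_definite_sum_nonneg[OF assms, of "{0::nat}" "\<lambda>_. 1" "\<lambda>_. 0"] by simp
    moreover have "(1 + s * s) * \<Psi> 0 + 2 * s * \<Psi> 0 = (1 + s)\<^sup>2 * \<Psi> 0"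
      by (simp add: power2_eq_square algebra_simps)
    ultimately show ?thesis using True by simp
  next
    case False
    then show ?thesis
      using positive_definite_sum_nonneg[OF assms, of "{0, x}" "\<lambda>y. if y = 0 then 1 else s" "\<lambda>y. y"]
      by (simp add: even algebra_simps)
  qed
  from this[of 1] this[of "-1"] show ?thesis by simp
qed

text \<open>Preimages of rectangles are cylinders over the coordinates \<open>i\<close> and
  \<open>j\<close>, and rectangles determine the product measure. This evaluates the expected kernel
  off the diagonal.\<close>

lemma distr_PiM_pair:
  assumes P: "prob_space P" and ij: "i \<in> I" "j \<in> I" "i \<noteq> j"
  shows "distr (\<Pi>\<^sub>M k\<in>I. P) (P \<Otimes>\<^sub>M P) (\<lambda>\<omega>. (\<omega> i, \<omega> j)) = P \<Otimes>\<^sub>M P"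
proof -
  interpret P: prob_space P by fact
  have [measurable]: "(\<lambda>\<omega>. \<omega> i) \<in> (\<Pi>\<^sub>M k\<in>I. P) \<rightarrow>\<^sub>M P" "(\<lambda>\<omega>. \<omega> j) \<in> (\<Pi>\<^sub>M k\<in>I. P) \<rightarrow>\<^sub>M P"
    using ij by (auto intro: measurable_component_singleton)
  show ?thesis
  proof (rule pair_measure_eqI[symmetric])
    show "sigma_finite_measure P" ..
    then show "sigma_finite_measure P" .
    fix A B assume A[measurable]: "A \<in> sets P" and B[measurable]: "B \<in> sets P"
    have "(\<lambda>\<omega>. (\<omega> i, \<omega> j)) -` (A \<times> B) \<inter> space (\<Pi>\<^sub>M k\<in>I. P) =
        prod_emb I (\<lambda>_. P) {i, j} (\<Pi>\<^sub>E k\<in>{i, j}. if k = i then A else B)"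
      using ij by (auto simp: prod_emb_def space_PiM PiE_iff)
    then have "emeasure (distr (\<Pi>\<^sub>M k\<in>I. P) (P \<Otimes>\<^sub>M P) (\<lambda>\<omega>. (\<omega> i, \<omega> j))) (A \<times> B) =
        emeasure (\<Pi>\<^sub>M k\<in>I. P) (prod_emb I (\<lambda>_. P) {i, j} (\<Pi>\<^sub>E k\<in>{i, j}. if k = i then A else B))"
      by (simp add: emeasure_distr)
    also have "\<dots> = (\<Prod>k\<in>{i, j}. emeasure P (if k = i then A else B))"
      using ij P by (intro emeasure_PiM_emb) auto
    also have "\<dots> = emeasure P A * emeasure P B"
      using ij by simp
    finally show "emeasure P A * emeasure P B =
        emeasure (distr (\<Pi>\<^sub>M k\<in>I. P) (P \<Otimes>\<^sub>M P) (\<lambda>\<omega>. (\<omega> i, \<omega> j))) (A \<times> B)" ..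
  qed simp
qed

text \<open>
  Summing the kernel over \<open>N\<close> independent samples of \<open>P\<close> and taking expectations gives
  \<open>0 \<le> N C + N (N - 1) \<integral>\<integral>K\<close>; the diagonal is negligible as \<open>N\<close> grows.
\<close>

lemma double_integral_kernel_nonneg:
  fixes K :: "'a \<Rightarrow> 'a \<Rightarrow> real"
  assumes P: "prob_space P"
    and meas[measurable]: "case_prod K \<in> borel_measurable (P \<Otimes>\<^sub>M P)"
    and bound: "\<And>x y. \<bar>K x y\<bar> \<le> C"
    and nonneg: "\<And>N (p :: nat \<Rightarrow> 'a). 0 \<le> (\<Sum>i<N. \<Sum>j<N. K (p i) (p j))"
  shows "0 \<le> (LINT x|P. LINT y|P. K x y)"
proof -
  interpret P: prob_space P by fact
  interpret PP: pair_prob_space P P ..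
  define q where "q = (LINT z|(P \<Otimes>\<^sub>M P). case_prod K z)"
  have "integrable (P \<Otimes>\<^sub>M P) (case_prod K)"
    by (rule PP.integrable_const_bound[of _ C]) (use bound in auto)
  then have q_eq: "(LINT x|P. LINT y|P. K x y) = q"
    unfolding q_def by (subst PP.integral_fst'[symmetric]) auto
  \<comment> \<open>A single infinite product carries the samples for every
    \<open>N\<close>.\<close>
  define S where "S = (\<Pi>\<^sub>M k\<in>(UNIV :: nat set). P)"
  interpret S: prob_space S unfolding S_def by (intro prob_space_PiM P)
  have [measurable]: "(\<lambda>\<omega>. \<omega> i) \<in> S \<rightarrow>\<^sub>M P" for i
    unfolding S_def by simp
  have meas': "(\<lambda>\<omega>. K (\<omega> i) (\<omega> j)) \<in> borel_measurable S" for i j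
    by measurable
  have int: "integrable S (\<lambda>\<omega>. K (\<omega> i) (\<omega> j))" for i j
    by (rule S.integrable_const_bound[of _ C]) (use bound meas' in auto)
  have off: "(LINT \<omega>|S. K (\<omega> i) (\<omega> j)) = q" if "i \<noteq> j" for i j
  proof -
    have "q = (LINT z|(distr S (P \<Otimes>\<^sub>M P) (\<lambda>\<omega>. (\<omega> i, \<omega> j))). case_prod K z)"
      unfolding q_def S_def using distr_PiM_pair[OF P _ _ that, of UNIV] by simp
    also have "\<dots> = (LINT \<omega>|S. K (\<omega> i) (\<omega> j))"
      by (subst integral_distr) auto
    finally show ?thesis ..
  qed
  have diag: "(LINT \<omega>|S. K (\<omega> i) (\<omega> i)) \<le> C" for i
    using bound by (intro S.integral_le_const int always_eventually) (auto simp: abs_le_iff)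
  \<comment> \<open>Among \<open>Suc N\<close> samples each row has one diagonal entry and
    \<open>N\<close> others, so dividing by the \<open>Suc N\<close> rows leaves exactly
    \<open>N * q\<close> beside \<open>C\<close>.\<close>
  have "0 \<le> C + real N * q" for N
  proof -
    let ?I = "{..<Suc N}"
    have "0 \<le> (LINT \<omega>|S. (\<Sum>i\<in>?I. \<Sum>j\<in>?I. K (\<omega> i) (\<omega> j)))"
      using nonneg by (intro Bochner_Integration.integral_nonneg) blast
    also have "\<dots> = (\<Sum>i\<in>?I. \<Sum>j\<in>?I. (LINT \<omega>|S. K (\<omega> i) (\<omega> j)))"
      using int by (simp add: Bochner_Integration.integral_sum del: sum.lessThan_Suc)
    also have "\<dots> \<le> (\<Sum>i\<in>?I. C + real N * q)"
    proof (rule sum_mono)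
      fix i assume i: "i \<in> ?I"
      have "(\<Sum>j\<in>?I. (LINT \<omega>|S. K (\<omega> i) (\<omega> j))) =
          (LINT \<omega>|S. K (\<omega> i) (\<omega> i)) + (\<Sum>j\<in>?I - {i}. (LINT \<omega>|S. K (\<omega> i) (\<omega> j)))"
        using i by (intro sum.remove) auto
      also have "(\<Sum>j\<in>?I - {i}. (LINT \<omega>|S. K (\<omega> i) (\<omega> j))) = (\<Sum>j\<in>?I - {i}. q)"
        by (intro sum.cong refl off) auto
      also have "\<dots> = real N * q"
        using i by (simp add: card_Diff_singleton del: lessThan_Suc)
      finally show "(\<Sum>j\<in>?I. (LINT \<omega>|S. K (\<omega> i) (\<omega> j))) \<le> C + real N * q"
        using diag[of i] by linarith
    qed
    also have "\<dots> = real (Suc N) * (C + real N * q)"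
      by (simp del: sum.lessThan_Suc)
    finally show ?thesis
      by (simp only: zero_le_mult_iff of_nat_0_le_iff) auto
  qed
  note lb = this
  show ?thesis
  proof (rule ccontr)
    assume "\<not> ?thesis"
    then have "q < 0" by (simp add: q_eq)
    then obtain N where "C < real N * (- q)"
      using reals_Archimedean3[of "- q"] by auto
    with lb[of N] show False by simp
  qed
qed

section \<open>Translations, reflections and overlapping balls\<close>

text \<open>The Jacobian is a power of \<open>\<bar>c\<bar>\<close>, hence 1. The case
  \<open>c = 1\<close> gives the translations used in ball averages, \<open>c = -1\<close> the
  reflection that removes the sine part of the transform.\<close>

lemma lborel_distr_isometry:
  fixes t :: "'a::euclidean_space"
  assumes "\<bar>c\<bar> = 1"
  shows "distr lborel borel (\<lambda>x. t + c *\<^sub>R x) = lborel"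
  using lborel_affine[of c t] assms by (auto simp: density_1)

lemma integral_lborel_isometry:
  fixes f :: "'a::euclidean_space \<Rightarrow> 'b::{banach, second_countable_topology}"
  assumes "\<bar>c\<bar> = 1" and [measurable]: "f \<in> borel_measurable borel"
  shows "(LINT x|lborel. f (t + c *\<^sub>R x)) = (LINT x|lborel. f x)"
  using integral_distr[of "\<lambda>x. t + c *\<^sub>R x" lborel borel f]
  by (simp add: lborel_distr_isometry assms(1))

lemma (in pair_sigma_finite) integrable_pair_mult:
  fixes f :: "'a \<Rightarrow> 'c::{real_normed_field, banach, second_countable_topology}"
  assumes f: "integrable M1 f" and g: "integrable M2 g"
  shows "integrable (M1 \<Otimes>\<^sub>M M2) (\<lambda>(x, y). f x * g y)"
proof -
  note [measurable] = borel_measurable_integrable[OF f] borel_measurable_integrable[OF g]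
  show ?thesis
    by (rule Fubini_integrable) (use f g in \<open>auto simp: norm_mult\<close>)
qed

lemma dist_minus_left: "dist (- u) y = norm (u + y)" for u y :: "'a::real_normed_vector"
  using norm_minus_cancel[of "u + y"] by (simp add: dist_norm)

text \<open>The overlap contains the concentric ball of radius \<open>r - norm u\<close>, so the
  ratio is at least \<open>(1 - norm u / r) ^ DIM('a)\<close>. The centre \<open>- u\<close> arises
  from asking that both \<open>y\<close> and \<open>u + y\<close> lie in the ball around 0.\<close>

lemma content_ball_overlap_tendsto:
  fixes u :: "'a::euclidean_space"
  defines "w \<equiv> \<lambda>r. measure lborel (ball 0 r \<inter> ball (- u) r) / measure lborel (ball (0::'a) r)"
  shows "(w \<longlongrightarrow> 1) at_top"
proof (rule tendsto_sandwich)
  have ball: "ball x r \<in> fmeasurable lborel" for x :: 'a and r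
    by (intro fmeasurableI emeasure_bounded_finite) auto
  have le: "measure lborel (ball 0 r \<inter> ball (- u) r) \<le> measure lborel (ball (0::'a) r)" for r
    by (intro measure_mono_fmeasurable ball) auto
  show "\<forall>\<^sub>F r in at_top. w r \<le> 1"
    unfolding w_def using le by (auto simp: divide_le_eq_1 intro!: always_eventually)
  show "\<forall>\<^sub>F r in at_top. ((r - norm u) / r) ^ DIM('a) \<le> w r"
  proof (rule eventually_at_top_linorderI)
    fix r assume r: "r \<ge> norm u + 1"
    then have r0: "r > 0" using norm_ge_zero[of u] by linarith
    have "ball (0::'a) (r - norm u) \<subseteq> ball 0 r \<inter> ball (- u) r"
    proof
      fix y :: 'a assume "y \<in> ball (0::'a) (r - norm u)"
      then have "norm y < r - norm u" by simp
      moreover have "0 \<le> norm u" by simp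
      ultimately have "norm y < r" "norm (u + y) < r"
        using norm_triangle_ineq[of u y] by linarith+
      then show "y \<in> ball 0 r \<inter> ball (- u) r"
        by (simp add: dist_minus_left)
    qed
    then have "measure lborel (ball (0::'a) (r - norm u)) \<le> measure lborel (ball 0 r \<inter> ball (- u) r)"
      by (rule measure_mono_fmeasurable) (auto intro!: fmeasurable.Int ball)
    then have "measure lborel (ball (0::'a) (r - norm u)) / measure lborel (ball (0::'a) r) \<le> w r"
      unfolding w_def by (intro divide_right_mono) auto
    also have "measure lborel (ball (0::'a) (r - norm u)) / measure lborel (ball (0::'a) r) =
        ((r - norm u) / r) ^ DIM('a)"
      using r r0 less_imp_neq[OF unit_ball_vol_pos, of "real DIM('a)"] content_ball[of r "0::'a"] content_ball[of "r - norm u" "0::'a"]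
      by (simp add: power_divide)
    finally show "((r - norm u) / r) ^ DIM('a) \<le> w r" .
  qed
  have "((\<lambda>r. (r - norm u) / r) \<longlongrightarrow> 1) at_top"
    by real_asymp
  then show "((\<lambda>r. ((r - norm u) / r) ^ DIM('a)) \<longlongrightarrow> 1) at_top"
    using tendsto_power by force
qed auto

text \<open>
  For two independent points uniformly distributed on a large ball, the density of the
  difference, rescaled by the volume, is close to \<open>1\<close>.
\<close>

lemma integral_nonneg_of_kernel_sums_nonneg:
  fixes f :: "'a::euclidean_space \<Rightarrow> real"
  assumes f: "integrable lborel f"
    and bound: "\<And>x. \<bar>f x\<bar> \<le> C"
    and nonneg: "\<And>N (p :: nat \<Rightarrow> 'a). 0 \<le> (\<Sum>i<N. \<Sum>j<N. f (p i - p j))"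
  shows "0 \<le> (LINT x|lborel. f x)"
proof -
  define w where "w r u = measure lborel (ball 0 r \<inter> ball (- u) r) /
      measure lborel (ball (0::'a) r)" for r and u :: 'a
  have f_meas[measurable]: "f \<in> borel_measurable borel"
    using f by auto
  have w01: "0 \<le> w r u" "w r u \<le> 1" for r u
  proof -
    have "measure lborel (ball 0 r \<inter> ball (- u) r) \<le> measure lborel (ball (0::'a) r)"
      by (intro measure_mono_fmeasurable fmeasurableI emeasure_bounded_finite) auto
    then show "0 \<le> w r u" "w r u \<le> 1"
      by (auto simp: w_def divide_le_eq_1)
  qed
  have ev: "0 \<le> (LINT u|lborel. f u * w r u)" and w_meas_pos: "w r \<in> borel_measurable borel" if r: "r > 0" for r
  proof -
    define B where "B = ball (0::'a) r"
    define v where "v = measure lborel B"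
    have v: "v > 0" using r by (simp add: v_def B_def)
    have [measurable]: "B \<in> sets borel" by (simp add: B_def)
    have emB: "emeasure lborel B = ennreal v"
      unfolding v_def B_def by (intro emeasure_eq_ennreal_measure) (use emeasure_bounded_finite[of "ball (0::'a) r"] in auto)
    \<comment> \<open>The uniform density on the ball, kept as a real function so that the double
      average becomes an integral over \<open>lborel\<close> where substitution is possible.\<close>
    define g where "g x = indicator B x / v" for x
    have g_meas[measurable]: "g \<in> borel_measurable borel"
      unfolding g_def by measurable
    have g: "integrable lborel g"
      unfolding g_def using emB by (intro integrable_divide integrable_real_indicator) auto
    have g0: "0 \<le> g x" and g1: "g x \<le> 1 / v" for x
      using v by (auto simp: g_def split: split_indicator)
    define P where "P = density lborel (\<lambda>x. ennreal (g x))"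
    have sP[measurable_cong]: "sets P = sets borel"
      by (simp add: P_def)
    have P: "prob_space P"
    proof
      have "(\<integral>\<^sup>+x. ennreal (g x) \<partial>lborel) = (\<integral>\<^sup>+x. ennreal (1 / v) * indicator B x \<partial>lborel)"
        using v by (intro nn_integral_cong) (auto simp: g_def split: split_indicator)
      also have "\<dots> = 1"
        using v by (simp add: nn_integral_cmult emB flip: ennreal_mult')
      finally show "emeasure P (space P) = 1"
        by (simp add: P_def emeasure_density)
    qed
    interpret P: prob_space P by fact
    have "0 \<le> (LINT x|P. LINT y|P. f (x - y))"
      by (rule double_integral_kernel_nonneg[OF P _ bound nonneg]) measurable
    also have "\<dots> = (LINT x|lborel. g x * (LINT y|P. f (x - y)))"
      unfolding P_def by (subst integral_density) (auto simp: g0 simp flip: P_def)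
    also have "\<dots> = (LINT x|lborel. LINT y|lborel. g x * (g y * f (x - y)))"
      unfolding P_def by (subst integral_density) (auto simp: g0)
    also have "\<dots> = (LINT y|lborel. LINT x|lborel. g x * (g y * f (x - y)))"
    proof (rule lborel_pair.Fubini_integral[symmetric])
      have "integrable (lborel \<Otimes>\<^sub>M lborel) (\<lambda>z. C * (case z of (x, y) \<Rightarrow> g x * g y))"
        by (intro integrable_mult_right lborel_pair.integrable_pair_mult g)
      then show "integrable (lborel \<Otimes>\<^sub>M lborel) (\<lambda>(x, y). g x * (g y * f (x - y)))"
      proof (rule Bochner_Integration.integrable_bound)
        show "AE z in lborel \<Otimes>\<^sub>M lborel. norm (case z of (x, y) \<Rightarrow> g x * (g y * f (x - y)))
            \<le> norm (C * (case z of (x, y) \<Rightarrow> g x * g y))"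
        proof (intro always_eventually allI, clarify)
          fix x y
          have "g x * (g y * \<bar>f (x - y)\<bar>) \<le> g x * (g y * \<bar>C\<bar>)"
            using bound[of "x - y"] by (intro mult_left_mono g0) linarith
          then show "norm (g x * (g y * f (x - y))) \<le> norm (C * (g x * g y))"
            by (simp add: abs_mult g0 mult_ac)
        qed
      qed measurable
    qed
    \<comment> \<open>Substitution \<open>x = u + y\<close> with \<open>y\<close> fixed, for which
      the preceding exchange made \<open>x\<close> the inner variable.\<close>
    also have "\<dots> = (LINT y|lborel. LINT u|lborel. g (u + y) * (g y * f u))"
      using integral_lborel_isometry[of 1 "\<lambda>x. g x * (g y * f (x - y))" y for y]
      by (simp add: add.commute)
    also have "\<dots> = (LINT u|lborel. LINT y|lborel. g (u + y) * (g y * f u))"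
    proof (rule lborel_pair.Fubini_integral)
      \<comment> \<open>Only one factor \<open>g\<close> is bounded by \<open>1 / v\<close>; the
        other keeps the majorant integrable in \<open>y\<close>, and \<open>f\<close> does so in
        \<open>u\<close>.\<close>
      have "integrable (lborel \<Otimes>\<^sub>M lborel) (\<lambda>z. 1 / v * (case z of (u, y) \<Rightarrow> f u * g y))"
        by (intro integrable_mult_right lborel_pair.integrable_pair_mult g f)
      then show "integrable (lborel \<Otimes>\<^sub>M lborel) (\<lambda>(u, y). g (u + y) * (g y * f u))"
      proof (rule Bochner_Integration.integrable_bound)
        show "AE z in lborel \<Otimes>\<^sub>M lborel. norm (case z of (u, y) \<Rightarrow> g (u + y) * (g y * f u))
            \<le> norm (1 / v * (case z of (u, y) \<Rightarrow> f u * g y))"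
        proof (intro always_eventually allI, clarify)
          fix u y
          have "g (u + y) * (g y * \<bar>f u\<bar>) \<le> 1 / v * (g y * \<bar>f u\<bar>)"
            by (intro mult_right_mono g1 mult_nonneg_nonneg g0) auto
          then show "norm (g (u + y) * (g y * f u)) \<le> norm (1 / v * (f u * g y))"
            using v by (simp add: abs_mult g0 mult_ac)
        qed
      qed measurable
    qed
    also have "\<dots> = (LINT u|lborel. f u * w r u / v)"
    proof (intro Bochner_Integration.integral_cong refl)
      fix u
      have "(LINT y|lborel. g (u + y) * (g y * f u)) =
          (LINT y|lborel. indicator (ball 0 r \<inter> ball (- u) r) y * (f u / v\<^sup>2))"
        by (intro Bochner_Integration.integral_cong refl)
          (auto simp: g_def B_def power2_eq_square dist_minus_left
            split: split_indicator)
      also have "\<dots> = measure lborel (ball 0 r \<inter> ball (- u) r) * (f u / v\<^sup>2)"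
        by simp
      also have "\<dots> = f u * w r u / v"
        by (simp add: w_def v_def B_def power2_eq_square)
      finally show "(LINT y|lborel. g (u + y) * (g y * f u)) = f u * w r u / v" .
    qed
    also have "\<dots> = (LINT u|lborel. f u * w r u) / v"
      by simp
    finally show "0 \<le> (LINT u|lborel. f u * w r u)"
      using v by (simp add: zero_le_divide_iff)
    \<comment> \<open>As a parameter integral of a jointly measurable function, the overlap is
      visibly measurable in \<open>u\<close>.\<close>
    have "w r = (\<lambda>u. LINT y|lborel. v * g (u + y) * g y)"
    proof
      fix u
      have "(LINT y|lborel. v * g (u + y) * g y) =
          (LINT y|lborel. indicator (ball 0 r \<inter> ball (- u) r) y * (1 / v))"
        using v by (intro Bochner_Integration.integral_cong refl)
          (auto simp: g_def B_def dist_minus_left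
            split: split_indicator)
      also have "\<dots> = w r u"
        by (simp add: w_def v_def B_def)
      finally show "w r u = (LINT y|lborel. v * g (u + y) * g y)" ..
    qed
    also have "\<dots> \<in> borel_measurable borel"
      by measurable
    finally show "w r \<in> borel_measurable borel" .
  qed
  have [measurable]: "w r \<in> borel_measurable borel" for r
  proof (cases "r > 0")
    case False
    \<comment> \<open>Here the balls are empty and the quotient is \<open>0 / 0 = 0\<close>.\<close>
    then have "w r = (\<lambda>_. 0)"
      by (simp add: w_def fun_eq_iff ball_empty)
    then show ?thesis by simp
  qed (rule w_meas_pos)
  have "((\<lambda>r. LINT u|lborel. f u * w r u) \<longlongrightarrow> (LINT u|lborel. f u * 1)) at_top"
  proof (rule integral_dominated_convergence_at_top[where w = "\<lambda>u. \<bar>f u\<bar>"])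
    show "AE u in lborel. ((\<lambda>r. f u * w r u) \<longlongrightarrow> f u * 1) at_top"
      unfolding w_def by (intro always_eventually allI tendsto_mult tendsto_const content_ball_overlap_tendsto)
    show "\<forall>\<^sub>F r in at_top. AE u in lborel. norm (f u * w r u) \<le> \<bar>f u\<bar>"
      using w01 by (auto simp: abs_mult intro!: mult_left_le always_eventually)
  qed (use f in auto)
  then have "0 \<le> (LINT u|lborel. f u * 1)"
    by (rule tendsto_lowerbound) (use ev in \<open>auto intro: eventually_at_top_linorderI[of 1]\<close>)
  then show ?thesis by simp
qed


section \<open>Gaussian weights\<close>

text \<open>Here \<open>c\<close> is an inverse standard deviation. Without a normalizing factor the
  weight tends to 1 pointwise as \<open>c\<close> tends to 0. The polymorphic type covers both
  vectors and their coordinates.\<close>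

definition gaussian :: "real \<Rightarrow> 'a::euclidean_space \<Rightarrow> real" where
  "gaussian c t = exp (- ((c * norm t)\<^sup>2) / 2)"

lemma gaussian_eq_prod: "gaussian c t = (\<Prod>b\<in>Basis. gaussian c (t \<bullet> b))"
proof -
  have "(norm t)\<^sup>2 = (\<Sum>b\<in>Basis. (t \<bullet> b)\<^sup>2)"
    unfolding power2_norm_eq_inner by (subst euclidean_inner) (simp add: power2_eq_square)
  then show ?thesis
    by (simp add: gaussian_def exp_sum[symmetric] power_mult_distrib sum_distrib_left
        sum_negf sum_divide_distrib del: exp_sum)
qed

lemma borel_measurable_gaussian[measurable]: "gaussian c \<in> borel_measurable borel"
  unfolding gaussian_def by measurable

lemma gaussian_pos: "0 < gaussian c t"
  by (simp add: gaussian_def)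

lemma
  assumes "c > 0"
  shows integrable_gaussian_real: "integrable lborel (gaussian c :: real \<Rightarrow> real)"
    and integral_gaussian_real: "(LINT x|lborel. gaussian c (x :: real)) = sqrt (2 * pi) / c"
    and integral_gaussian_real_exp:
      "(LINT x|lborel. complex_of_real (gaussian c x) * exp (\<i> * complex_of_real (s * x))) =
        sqrt (2 * pi) / c * gaussian (1 / c) s"
proof -
  have eq: "gaussian c x = sqrt (2 * pi) * std_normal_density (c * x)" for x :: real
    by (simp add: gaussian_def std_normal_density_def power_mult_distrib)
  have std: "integrable lborel std_normal_density" "(LINT x|lborel. std_normal_density x) = 1"
    using integrable_normal_density[of 1 0] integral_normal_density[of 1 0] by simp_all
  show "integrable lborel (gaussian c :: real \<Rightarrow> real)"
    using lborel_integrable_real_affine[OF std(1), of c 0] assms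
    by (simp add: eq cong: Bochner_Integration.integrable_cong)
  show "(LINT x|lborel. gaussian c (x :: real)) = sqrt (2 * pi) / c"
    using lborel_integral_real_affine[of c std_normal_density 0] assms
    by (simp add: eq std(2) field_simps)
  \<comment> \<open>The integrand of the characteristic function of the standard normal law at
    \<open>s / c\<close>; rescaling by \<open>c\<close> turns it into the wanted integral.\<close>
  define h where "h x = exp (\<i> * complex_of_real (s / c * x)) * complex_of_real (std_normal_density x)" for x
  have "(LINT x|lborel. h x) = char std_normal_distribution (s / c)"
    unfolding h_def char_def by (subst integral_density) (auto simp: scaleR_conv_of_real mult.commute)
  also have "\<dots> = gaussian (1 / c) s"
    by (simp add: char_std_normal_distribution gaussian_def power_divide)
  finally have h: "(LINT x|lborel. h x) = gaussian (1 / c) s" .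
  have "(LINT x|lborel. complex_of_real (gaussian c x) * exp (\<i> * complex_of_real (s * x))) =
      (LINT x|lborel. complex_of_real (sqrt (2 * pi)) * h (0 + c * x))"
    using assms by (intro Bochner_Integration.integral_cong refl) (simp add: eq h_def field_simps)
  also have "\<dots> = sqrt (2 * pi) / c * gaussian (1 / c) s"
    using lborel_integral_real_affine[of c h 0] assms
    by (simp add: h scaleR_conv_of_real field_simps)
  finally show "(LINT x|lborel. complex_of_real (gaussian c x) * exp (\<i> * complex_of_real (s * x))) =
        sqrt (2 * pi) / c * gaussian (1 / c) s" by simp
qed

text \<open>By \<open>lborel_eq\<close>, Lebesgue measure is the image of a product of
  one-dimensional Lebesgue measures under the coordinate map, which reduces Gaussian integrals to
  the real line.\<close>

lemma
  fixes f :: "'a::euclidean_space \<Rightarrow> real \<Rightarrow> 'b::{real_normed_field, banach, second_countable_topology}"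
  assumes f: "\<And>b. b \<in> Basis \<Longrightarrow> integrable lborel (f b)"
  shows integrable_lborel_prod: "integrable lborel (\<lambda>x. \<Prod>b\<in>Basis. f b (x \<bullet> b))"
    and integral_lborel_prod:
      "(LINT x|lborel. (\<Prod>b\<in>Basis. f b (x \<bullet> b))) = (\<Prod>b\<in>Basis. LINT x|lborel. f b x)"
proof -
  interpret product_sigma_finite "\<lambda>b::'a. lborel :: real measure" ..
  have fm: "f b \<in> borel_measurable borel" if "b \<in> Basis" for b
    using borel_measurable_integrable[OF f[OF that]] by simp
  have meas: "(\<lambda>x. \<Prod>b\<in>Basis. f b (x \<bullet> b)) \<in> borel_measurable borel"
    by (intro borel_measurable_prod measurable_compose[OF _ fm]) auto
  have T: "(\<lambda>p. \<Sum>b\<in>Basis. p b *\<^sub>R b) \<in> (\<Pi>\<^sub>M b\<in>(Basis :: 'a set). lborel) \<rightarrow>\<^sub>M borel"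
    by measurable
  show "integrable lborel (\<lambda>x. \<Prod>b\<in>Basis. f b (x \<bullet> b))"
    by (subst lborel_eq, subst integrable_distr_eq[OF T meas])
      (use product_integrable_prod[OF finite_Basis f] in simp)
  show "(LINT x|lborel. (\<Prod>b\<in>Basis. f b (x \<bullet> b))) = (\<Prod>b\<in>Basis. LINT x|lborel. f b x)"
    by (subst lborel_eq, subst integral_distr[OF T meas])
      (use product_integral_prod[OF finite_Basis f] in simp)
qed

lemma
  fixes s :: "'a::euclidean_space"
  assumes "c > 0"
  shows integrable_gaussian: "integrable lborel (gaussian c :: 'a \<Rightarrow> real)"
    and integral_gaussian: "(LINT x|lborel. gaussian c (x :: 'a)) = (sqrt (2 * pi) / c) ^ DIM('a)"
    and integral_gaussian_exp:
      "(LINT x|lborel. complex_of_real (gaussian c x) * exp (\<i> * complex_of_real (s \<bullet> x))) =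
        complex_of_real ((sqrt (2 * pi) / c) ^ DIM('a) * gaussian (1 / c) s)"
proof -
  show "integrable lborel (gaussian c :: 'a \<Rightarrow> real)"
    using integrable_lborel_prod[OF integrable_gaussian_real[OF assms]]
    by (subst gaussian_eq_prod[abs_def])
  show "(LINT x|lborel. gaussian c (x :: 'a)) = (sqrt (2 * pi) / c) ^ DIM('a)"
    by (subst gaussian_eq_prod, subst integral_lborel_prod)
      (auto simp: integrable_gaussian_real integral_gaussian_real assms)
  let ?f = "\<lambda>b x. complex_of_real (gaussian c x) * exp (\<i> * complex_of_real ((s \<bullet> b) * x))"
  have "(LINT x|lborel. complex_of_real (gaussian c x) * exp (\<i> * complex_of_real (s \<bullet> x))) =
      (LINT x|lborel. (\<Prod>b\<in>Basis. ?f b (x \<bullet> b)))"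
    by (subst gaussian_eq_prod, subst euclidean_inner[of s])
      (simp add: prod.distrib exp_sum[symmetric] sum_distrib_left del: of_real_mult)
  also have "\<dots> = (\<Prod>b\<in>(Basis :: 'a set). LINT x|lborel. ?f b x)"
  proof (rule integral_lborel_prod)
    fix b :: 'a
    show "integrable lborel (?f b)"
      by (rule Bochner_Integration.integrable_bound[OF integrable_gaussian_real[OF assms]])
        (auto simp: norm_mult simp del: of_real_mult)
  qed
  also have "\<dots> = (\<Prod>b\<in>(Basis :: 'a set). complex_of_real (sqrt (2 * pi) / c * gaussian (1 / c) (s \<bullet> b)))"
    by (simp only: integral_gaussian_real_exp[OF assms])
  also have "\<dots> = complex_of_real ((sqrt (2 * pi) / c) ^ DIM('a) * gaussian (1 / c) s)"
    by (simp only: of_real_prod[symmetric] prod.distrib prod_constant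
        gaussian_eq_prod[of "1 / c" s, symmetric])
  finally show "(LINT x|lborel. complex_of_real (gaussian c x) * exp (\<i> * complex_of_real (s \<bullet> x))) =
        complex_of_real ((sqrt (2 * pi) / c) ^ DIM('a) * gaussian (1 / c) s)" .
qed


section \<open>Transforms of positive definite functions\<close>

text \<open>Evenness of \<open>\<Psi>\<close> makes the sine part odd, so its integral vanishes. For
  the cosine part, the addition formula splits the kernel sums into two real quadratic forms,
  weighted by cosines and by sines, so real coefficients suffice.\<close>

lemma fourier_positive_definite:
  fixes \<Psi> :: "'a::euclidean_space \<Rightarrow> real"
  assumes pd: "positive_definite \<Psi>" and int: "integrable lborel \<Psi>"
  shows "\<exists>r\<ge>0. fourier \<Psi> \<omega> = complex_of_real r"
proof -
  have even: "\<Psi> (- x) = \<Psi> x" for x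
    using pd by (simp add: positive_definite_def)
  have meas[measurable]: "\<Psi> \<in> borel_measurable borel"
    using int by auto
  define C where "C x = \<Psi> x * cos (x \<bullet> \<omega>)" for x
  define S where "S x = \<Psi> x * sin (x \<bullet> \<omega>)" for x
  have C_int: "integrable lborel C" and S_int: "integrable lborel S"
    unfolding C_def S_def
    by (auto intro!: Bochner_Integration.integrable_bound[OF int] always_eventually mult_left_le simp: abs_mult)
  have "0 \<le> (LINT x|lborel. C x)"
  proof (rule integral_nonneg_of_kernel_sums_nonneg[OF C_int])
    show "\<bar>C x\<bar> \<le> \<Psi> 0" for x
      using positive_definite_bound[OF pd, of x]
      by (auto simp: C_def abs_mult intro: order_trans[OF mult_left_le])
    fix N and p :: "nat \<Rightarrow> 'a"
    have "(\<Sum>i<N. \<Sum>j<N. C (p i - p j)) =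
        (\<Sum>i<N. \<Sum>j<N. cos (p i \<bullet> \<omega>) * cos (p j \<bullet> \<omega>) * \<Psi> (p i - p j)) +
        (\<Sum>i<N. \<Sum>j<N. sin (p i \<bullet> \<omega>) * sin (p j \<bullet> \<omega>) * \<Psi> (p i - p j))"
      by (simp add: C_def inner_diff_left cos_diff sum.distrib[symmetric] algebra_simps)
    also have "\<dots> \<ge> 0"
      by (intro add_nonneg_nonneg positive_definite_sum_nonneg[OF pd, where c = "\<lambda>x. cos (x \<bullet> \<omega>)"]
          positive_definite_sum_nonneg[OF pd, where c = "\<lambda>x. sin (x \<bullet> \<omega>)"]) auto
    finally show "0 \<le> (\<Sum>i<N. \<Sum>j<N. C (p i - p j))" .
  qed
  moreover have "(LINT x|lborel. S x) = 0"
  proof -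
    have "(LINT x|lborel. S x) = (LINT x|lborel. S (0 + (- 1) *\<^sub>R x))"
      by (rule integral_lborel_isometry[symmetric]) (use S_int in auto)
    also have "\<dots> = - (LINT x|lborel. S x)"
      by (simp add: S_def even)
    finally show ?thesis by simp
  qed
  moreover have "(LINT x|lborel. complex_of_real (\<Psi> x) * exp (- \<i> * complex_of_real (x \<bullet> \<omega>))) =
      (LINT x|lborel. complex_of_real (C x) - \<i> * complex_of_real (S x))"
    by (intro Bochner_Integration.integral_cong refl)
      (auto simp: complex_eq_iff C_def S_def Re_exp Im_exp)
  moreover have "\<dots> = complex_of_real (LINT x|lborel. C x) - \<i> * complex_of_real (LINT x|lborel. S x)"
    using C_int S_int
    by (subst Bochner_Integration.integral_diff) auto
  ultimately show ?thesis
    unfolding fourier_def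
    by (intro exI[of _ "(2 * pi) powr (- real DIM('a) / 2) * (LINT x|lborel. C x)"]) auto
qed

text \<open>
  Weighting the transform with wide Gaussians, Fubini's theorem moves the weight onto \<open>\<Psi>\<close>,
  where it becomes a multiple of a probability density and the boundedness of \<open>\<Psi>\<close> suffices.
\<close>

lemma integrable_fourier_if_nonneg:
  fixes \<Psi> :: "'a::euclidean_space \<Rightarrow> real"
  assumes int: "integrable lborel \<Psi>" and bound: "\<And>x. \<bar>\<Psi> x\<bar> \<le> C"
    and nonneg: "\<And>\<omega>. \<exists>r\<ge>0. fourier \<Psi> \<omega> = complex_of_real r"
  shows "integrable lborel (fourier \<Psi>)"
proof -
  define k where "k = (2 * pi) powr (- real DIM('a) / 2)"
  define F where "F \<omega> = Re (fourier \<Psi> \<omega>)" for \<omega>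
  have F: "fourier \<Psi> \<omega> = complex_of_real (F \<omega>)" and F0: "F \<omega> \<ge> 0" for \<omega>
    using nonneg[of \<omega>] by (auto simp: F_def)
  have meas[measurable]: "\<Psi> \<in> borel_measurable borel"
    using int by auto
  have [measurable]: "fourier \<Psi> \<in> borel_measurable borel"
    unfolding fourier_def by measurable
  have F_meas[measurable]: "F \<in> borel_measurable borel"
    unfolding F_def by measurable
  have k: "k \<ge> 0" by (simp add: k_def)
  \<comment> \<open>The transform of \<open>gaussian c\<close> has the factor
    \<open>(sqrt (2 * pi) / c) ^ DIM('a)\<close>, and \<open>gaussian (1 / c)\<close> has mass
    \<open>(sqrt (2 * pi) * c) ^ DIM('a)\<close>. In the product \<open>c\<close> cancels, so the
    bound is uniform in \<open>c\<close>.\<close>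
  define K where "K = k * (C * (2 * pi) ^ DIM('a))"
  have le: "(\<integral>\<^sup>+t. ennreal (F t * gaussian c t) \<partial>lborel) \<le> ennreal K" if c: "c > 0" for c
  proof -
    define h where "h t x = complex_of_real (gaussian c t) *
        (complex_of_real (\<Psi> x) * exp (- \<i> * complex_of_real (x \<bullet> t)))" for t x
    \<comment> \<open>The exponential has modulus 1: the Gaussian gives integrability in
      \<open>t\<close> and \<open>\<Psi>\<close> gives it in \<open>x\<close>. Without the weight,
      Fubini's theorem would not apply.\<close>
    have h_int: "integrable (lborel \<Otimes>\<^sub>M lborel) (\<lambda>(t, x). h t x)"
    proof (rule Bochner_Integration.integrable_bound)
      show "integrable (lborel \<Otimes>\<^sub>M lborel) (\<lambda>(t :: 'a, x). gaussian c t * \<Psi> x)"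
        by (rule lborel_pair.integrable_pair_mult[OF integrable_gaussian[OF c] int])
      show "(\<lambda>(t, x). h t x) \<in> borel_measurable (lborel \<Otimes>\<^sub>M lborel)"
        unfolding h_def by measurable
      show "AE z in lborel \<Otimes>\<^sub>M lborel. norm (case z of (t, x) \<Rightarrow> h t x)
          \<le> norm (case z of (t :: 'a, x) \<Rightarrow> gaussian c t * \<Psi> x)"
        by (auto simp: h_def norm_mult)
    qed
    have h_inner: "k * (LINT x|lborel. h t x) = complex_of_real (F t * gaussian c t)" for t
    proof -
      have "k * (LINT x|lborel. h t x) = gaussian c t * fourier \<Psi> t"
        unfolding h_def fourier_def k_def by simp
      then show ?thesis by (simp add: F)
    qed
    have "integrable lborel (\<lambda>t. k * (LINT x|lborel. h t x))"
      using lborel_pair.integrable_fst'[OF h_int] by simp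
    then have FG_int: "integrable lborel (\<lambda>t. F t * gaussian c t)"
      unfolding h_inner by (simp only: complex_of_real_integrable_eq)
    have "complex_of_real (LINT t|lborel. F t * gaussian c t) = (LINT t|lborel. k * (LINT x|lborel. h t x))"
      unfolding h_inner by (simp only: integral_complex_of_real)
    also have "\<dots> = k * (LINT x|lborel. LINT t|lborel. h t x)"
      using lborel_pair.Fubini_integral[OF h_int] by simp
    also have "\<dots> = k * (LINT x|lborel. complex_of_real (\<Psi> x * ((sqrt (2 * pi) / c) ^ DIM('a) * gaussian (1 / c) x)))"
    proof -
      have "(LINT t|lborel. h t x) =
          complex_of_real (\<Psi> x * ((sqrt (2 * pi) / c) ^ DIM('a) * gaussian (1 / c) x))" for x
      proof -
        have "(LINT t|lborel. h t x) = (LINT t|lborel. complex_of_real (\<Psi> x) *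
            (complex_of_real (gaussian c t) * exp (\<i> * complex_of_real ((- x) \<bullet> t))))"
          unfolding h_def by (intro Bochner_Integration.integral_cong refl) simp
        also have "\<dots> = complex_of_real (\<Psi> x) *
            (LINT t|lborel. complex_of_real (gaussian c t) * exp (\<i> * complex_of_real ((- x) \<bullet> t)))"
          by (rule integral_mult_right_zero)
        \<comment> \<open>The minus sign of \<open>- x\<close> disappears because
          \<open>gaussian\<close> depends on the norm only.\<close>
        also have "\<dots> = complex_of_real (\<Psi> x * ((sqrt (2 * pi) / c) ^ DIM('a) * gaussian (1 / c) x))"
          unfolding integral_gaussian_exp[OF c] by (simp add: gaussian_def)
        finally show ?thesis .
      qed
      then show ?thesis by simp
    qed
    finally have "complex_of_real (LINT t|lborel. F t * gaussian c t) = complex_of_real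
        (k * (LINT x|lborel. \<Psi> x * ((sqrt (2 * pi) / c) ^ DIM('a) * gaussian (1 / c) x)))"
      by (simp only: integral_complex_of_real of_real_mult[of k])
    then have "(LINT t|lborel. F t * gaussian c t) =
        k * (LINT x|lborel. \<Psi> x * ((sqrt (2 * pi) / c) ^ DIM('a) * gaussian (1 / c) x))"
      by (simp only: of_real_eq_iff)
    also have "\<dots> \<le> k * (LINT x|lborel. C * ((sqrt (2 * pi) / c) ^ DIM('a) * gaussian (1 / c) (x :: 'a)))"
    proof (intro mult_left_mono k integral_mono)
      have G: "integrable lborel (\<lambda>x. (sqrt (2 * pi) / c) ^ DIM('a) * gaussian (1 / c) (x :: 'a))"
        using c by (intro integrable_mult_right integrable_gaussian) auto
      then show CG: "integrable lborel (\<lambda>x. C * ((sqrt (2 * pi) / c) ^ DIM('a) * gaussian (1 / c) (x :: 'a)))"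
        by (rule integrable_mult_right)
      have G0: "0 \<le> (sqrt (2 * pi) / c) ^ DIM('a) * gaussian (1 / c) (x :: 'a)" for x
        using c gaussian_pos[of "1 / c" x] by auto
      show "\<Psi> x * ((sqrt (2 * pi) / c) ^ DIM('a) * gaussian (1 / c) x) \<le>
          C * ((sqrt (2 * pi) / c) ^ DIM('a) * gaussian (1 / c) x)" for x
        using bound[of x] by (intro mult_right_mono G0) auto
      have "\<bar>\<Psi> x\<bar> \<le> \<bar>C\<bar>" for x
        using bound[of x] by linarith
      then show "integrable lborel (\<lambda>x. \<Psi> x * ((sqrt (2 * pi) / c) ^ DIM('a) * gaussian (1 / c) x))"
        by (intro Bochner_Integration.integrable_bound[OF CG])
          (use G0 in \<open>auto simp: abs_mult intro!: mult_right_mono\<close>)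
    qed
    also have "\<dots> = K"
    proof -
      have "(sqrt (2 * pi) / c) * (sqrt (2 * pi) / (1 / c)) = sqrt (2 * pi) * sqrt (2 * pi)"
        using c by (simp only: field_simps) simp
      also have "\<dots> = 2 * pi"
        by (rule real_sqrt_mult_self[THEN trans]) simp
      finally have "(sqrt (2 * pi) / c) ^ DIM('a) * (sqrt (2 * pi) / (1 / c)) ^ DIM('a) = (2 * pi) ^ DIM('a)"
        by (simp only: power_mult_distrib[symmetric])
      moreover have "(LINT x|lborel. gaussian (1 / c) (x :: 'a)) = (sqrt (2 * pi) / (1 / c)) ^ DIM('a)"
        using c by (intro integral_gaussian) simp
      ultimately show ?thesis
        by (simp only: integral_mult_right_zero K_def)
    qed
    finally have "(LINT t|lborel. F t * gaussian c t) \<le> K" .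
    then show ?thesis
      using FG_int F0 gaussian_pos
      by (subst nn_integral_eq_integral) (auto intro!: ennreal_leI mult_nonneg_nonneg less_imp_le[OF gaussian_pos])
  qed
  have "(\<integral>\<^sup>+t. ennreal (F t) \<partial>lborel) =
      (\<integral>\<^sup>+t. liminf (\<lambda>n. ennreal (F t * gaussian (1 / real (Suc n)) t)) \<partial>lborel)"
  proof (intro nn_integral_cong)
    fix t :: 'a
    \<comment> \<open>The choice \<open>c = 1 / Suc n\<close> stays positive, as \<open>le\<close>
      demands, while the weights tend to 1.\<close>
    have "(\<lambda>n. gaussian (1 / real (Suc n)) t) \<longlonglongrightarrow> exp (- ((0 * norm t)\<^sup>2) / 2)"
      unfolding gaussian_def
      by (intro tendsto_intros LIMSEQ_Suc[OF lim_1_over_n]) auto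
    then have "(\<lambda>n. ennreal (F t * gaussian (1 / real (Suc n)) t)) \<longlonglongrightarrow> ennreal (F t * 1)"
      by (intro tendsto_ennrealI tendsto_mult tendsto_const) simp
    then show "ennreal (F t) = liminf (\<lambda>n. ennreal (F t * gaussian (1 / real (Suc n)) t))"
      by (simp add: lim_imp_Liminf)
  qed
  also have "\<dots> \<le> liminf (\<lambda>n. \<integral>\<^sup>+t. ennreal (F t * gaussian (1 / real (Suc n)) t) \<partial>lborel)"
    by (intro nn_integral_liminf) measurable
  also have "\<dots> \<le> limsup (\<lambda>n. \<integral>\<^sup>+t. ennreal (F t * gaussian (1 / real (Suc n)) t) \<partial>lborel)"
    by (rule Liminf_le_Limsup) simp
  also have "\<dots> \<le> ennreal K"
    by (intro Limsup_bounded always_eventually allI le) simp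
  finally have "integrable lborel F"
    using F0 by (intro integrableI_nonneg) (auto simp: top.extremum_strict le_less_trans)
  then have "integrable lborel (\<lambda>t. complex_of_real (F t))"
    by simp
  then show ?thesis
    by (simp add: F[abs_def])
qed

section \<open>Characteristic functions and the limit\<close>

text \<open>The easy direction of Levy's continuity theorem. Since \<open>weakly_converges\<close>
  tests real functions, the exponential is split into cosine and sine, both bounded and
  continuous.\<close>

lemma integral_exp_tendsto_1:
  fixes X :: "nat \<Rightarrow> 's \<Rightarrow> 'a::euclidean_space"
  assumes M: "prob_space M" and X[measurable]: "\<And>n. X n \<in> borel_measurable M"
    and conv: "weakly_converges (\<lambda>n. distr M borel (X n)) (return borel 0)"
  shows "(\<lambda>n. LINT w|M. exp (\<i> * complex_of_real (X n w \<bullet> t))) \<longlonglongrightarrow> 1"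
proof -
  interpret prob_space M by fact
  have lim: "(\<lambda>n. LINT w|M. f (X n w)) \<longlonglongrightarrow> f 0"
    if f: "continuous_on UNIV f" "bounded (range f)" for f :: "'a \<Rightarrow> real"
  proof -
    have [measurable]: "f \<in> borel_measurable borel"
      using f(1) by (rule borel_measurable_continuous_onI)
    have "(\<lambda>n. integral\<^sup>L (distr M borel (X n)) f) \<longlonglongrightarrow> integral\<^sup>L (return borel 0) f"
      using conv f unfolding weakly_converges_def by blast
    then show ?thesis
      by (simp add: integral_distr integral_return)
  qed
  have "(\<lambda>n. LINT w|M. cos (X n w \<bullet> t)) \<longlonglongrightarrow> cos (0 \<bullet> t)"
    by (rule lim) (auto intro!: continuous_intros boundedI[of _ 1])
  moreover have "(\<lambda>n. LINT w|M. sin (X n w \<bullet> t)) \<longlonglongrightarrow> sin (0 \<bullet> t)"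
    by (rule lim) (auto intro!: continuous_intros boundedI[of _ 1])
  ultimately have "(\<lambda>n. complex_of_real (LINT w|M. cos (X n w \<bullet> t)) +
      \<i> * complex_of_real (LINT w|M. sin (X n w \<bullet> t))) \<longlonglongrightarrow>
      complex_of_real (cos (0 \<bullet> t)) + \<i> * complex_of_real (sin (0 \<bullet> t))"
    by (intro tendsto_intros)
  moreover have "(LINT w|M. exp (\<i> * complex_of_real (X n w \<bullet> t))) =
      complex_of_real (LINT w|M. cos (X n w \<bullet> t)) + \<i> * complex_of_real (LINT w|M. sin (X n w \<bullet> t))" for n
  proof -
    have "integrable M (\<lambda>w. cos (X n w \<bullet> t))" "integrable M (\<lambda>w. sin (X n w \<bullet> t))"
      by (auto intro!: integrable_const_bound[of _ 1])
    then have "complex_of_real (LINT w|M. cos (X n w \<bullet> t)) + \<i> * complex_of_real (LINT w|M. sin (X n w \<bullet> t)) =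
        (LINT w|M. complex_of_real (cos (X n w \<bullet> t)) + \<i> * complex_of_real (sin (X n w \<bullet> t)))"
      by (subst Bochner_Integration.integral_add) auto
    also have "\<dots> = (LINT w|M. exp (\<i> * complex_of_real (X n w \<bullet> t)))"
      by (intro Bochner_Integration.integral_cong refl) (auto simp: complex_eq_iff Re_exp Im_exp)
    finally show ?thesis ..
  qed
  ultimately show ?thesis by simp
qed

text \<open>Integrability is part of the conclusion because the Bochner integral of a nonintegrable
  function is 0, so the limit alone could hold for the wrong reason.\<close>

theorem proposition3p1:
  fixes \<Omega> :: "(real ^ 'd) set"
    and \<Psi> :: "real ^ 'd \<Rightarrow> real"
    and \<phi> :: "real \<Rightarrow> real"
    and \<sigma> m :: real
    and M :: "'s measure"
    and \<epsilon> :: "nat \<Rightarrow> 's \<Rightarrow> real ^ 'd"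
    and b :: "nat \<Rightarrow> real ^ 'd \<Rightarrow> complex"
    and a :: "nat \<Rightarrow> complex"
  assumes "convex \<Omega>" and "compact \<Omega>"
    and "\<sigma>\<^sup>2 > 0"
    and "integrable lborel \<Psi>" and "continuous_on UNIV \<Psi>"
    and "positive_definite \<Psi>" and "\<Psi> 0 = 1"
    and "\<And>s t. \<Psi> (s - t) = \<phi> (norm (s - t))"
    and "\<And>r. r \<ge> 0 \<Longrightarrow> \<phi> r > 0"
    and "strict_antimono_on {0..} \<phi>"
    and "\<phi> 0 = 1"
    and "m > real CARD('d) / 2"
    and "native_embeds_sobolev \<Psi> m \<Omega>"
    and "prob_space M"
    and "prob_space.indep_vars M (\<lambda>_. borel) \<epsilon> UNIV"
    and "weakly_converges (\<lambda>n. distr M borel (\<epsilon> n)) (return borel 0)"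
    and b_def: "\<And>n t. b n t = (LINT w|M. exp (\<i> * complex_of_real (\<epsilon> n w \<bullet> t)))"
    and a_def: "\<And>n. a n = complex_of_real (\<sigma>\<^sup>2 / (2 * pi) powr (real CARD('d) / 2)) *
          (LINT t|lborel. complex_of_real (\<bar>1 - cmod (b n t)\<bar>\<^sup>2) * fourier \<Psi> t)"
  shows "(\<forall>n. integrable lborel (\<lambda>t. complex_of_real (\<bar>1 - cmod (b n t)\<bar>\<^sup>2) * fourier \<Psi> t)) \<and>
         a \<longlonglongrightarrow> 0"
proof -
  interpret prob_space M by fact
  \<comment> \<open>Measurability of each \<open>\<epsilon> n\<close> is contained in
    \<open>indep_vars\<close>.\<close>
  have \<epsilon>[measurable]: "\<epsilon> n \<in> borel_measurable M" for n
    using assms(15) by (auto simp: indep_vars_def)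
  have F: "integrable lborel (fourier \<Psi>)"
    using assms(4,6) by (intro integrable_fourier_if_nonneg[where C = "\<Psi> 0"])
      (auto intro: positive_definite_bound fourier_positive_definite)
  have [measurable]: "fourier \<Psi> \<in> borel_measurable borel"
    using F by auto
  have [measurable]: "b n \<in> borel_measurable borel" for n
    unfolding b_def[abs_def] by measurable
  have b1: "cmod (b n t) \<le> 1" for n t
  proof -
    have "cmod (b n t) \<le> (LINT w|M. cmod (exp (\<i> * complex_of_real (\<epsilon> n w \<bullet> t))))"
      unfolding b_def by (rule integral_norm_bound)
    then show ?thesis by (simp add: prob_space)
  qed
  have bound: "norm (complex_of_real (\<bar>1 - cmod (b n t)\<bar>\<^sup>2) * fourier \<Psi> t) \<le> norm (fourier \<Psi> t)" for n t
  proof -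
    have "\<bar>1 - cmod (b n t)\<bar>\<^sup>2 * norm (fourier \<Psi> t) \<le> 1 * norm (fourier \<Psi> t)"
      using b1[of n t] by (intro mult_right_mono power_le_one) auto
    then show ?thesis
      by (simp only: norm_mult norm_of_real abs_power2 mult_1)
  qed
  have "integrable lborel (\<lambda>t. complex_of_real (\<bar>1 - cmod (b n t)\<bar>\<^sup>2) * fourier \<Psi> t)" for n
    by (rule Bochner_Integration.integrable_bound[OF F]) (use bound in auto)
  moreover have "(\<lambda>n. LINT t|lborel. complex_of_real (\<bar>1 - cmod (b n t)\<bar>\<^sup>2) * fourier \<Psi> t)
      \<longlonglongrightarrow> (LINT t|(lborel :: (real ^ 'd) measure). 0)"
  proof (rule integral_dominated_convergence[where w = "\<lambda>t. norm (fourier \<Psi> t)"])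
    have "(\<lambda>n. b n t) \<longlonglongrightarrow> 1" for t
      unfolding b_def using integral_exp_tendsto_1[OF assms(14) \<epsilon> assms(16)] .
    then have "(\<lambda>n. complex_of_real (\<bar>1 - cmod (b n t)\<bar>\<^sup>2) * fourier \<Psi> t)
        \<longlonglongrightarrow> complex_of_real (\<bar>1 - cmod 1\<bar>\<^sup>2) * fourier \<Psi> t" for t
      by (intro tendsto_intros)
    then show "AE t in lborel. (\<lambda>n. complex_of_real (\<bar>1 - cmod (b n t)\<bar>\<^sup>2) * fourier \<Psi> t) \<longlonglongrightarrow> 0"
      by simp
  qed (use F bound in auto)
  then have "a \<longlonglongrightarrow> complex_of_real (\<sigma>\<^sup>2 / (2 * pi) powr (real CARD('d) / 2)) * 0"
    unfolding a_def[abs_def] by (intro tendsto_mult tendsto_const) simp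
  ultimately show ?thesis by simp
qed

end
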